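(* Let $p$ be an odd prime, $r=(p-1)/2$, $\zeta_p=e^{2\pi i/p}$, $\varepsilon=(-1)^{(p-1)/2}$, and let $\sqrt{\varepsilon p}=\sum_{x\in\mathbb{Z}/p\mathbb{Z}}\zeta_p^{x^2}$. Let $Q$ be either $Q_1(x)=x^2/p$ or $Q_2(x)=cx^2/p$ with $c$ a fixed quadratic non-residue mod $p$, and $B(x,y)=Q(x+y)-Q(x)-Q(y)$. Let $S$ be the $(r+1)\times(r+1)$ matrix indexed by $0\le j,k\le r$ with $S_{j0}=1/\sqrt{\varepsilon p}$ for all $j$, $S_{0k}=2/\sqrt{\varepsilon p}$ for $1\le k\le r$, and $S_{jk}=\frac{1}{\sqrt{\varepsilon p}}\left(e^{-2\pi iB(j,k)}+e^{2\pi iB(j,k)}\right)$ for $1\le j,k\le r$. Let $\theta_j=e^{2\pi iQ(j)}$ ($0\le j\le r$) and let $V_Q$ be the Vandermonde matrix with $(j,k)$ entry $\theta_j^{\,k}$ ($0\le j,k\le r$). Then every entry of $S'=V_Q^{-1}SV_Q$ lies in $\mathbb{Z}\left[\frac{1}{2}(1+\sqrt{\varepsilon p})\right]$, the ring of integers of $\mathbb{Q}(\sqrt{\varepsilon p})$.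
   Context: $\sqrt{\varepsilon p}$ equals $\sqrt p$ if $p\equiv1\pmod 4$ and $i\sqrt p$ if $p\equiv 3\pmod 4$. The $\theta_j$ are pairwise distinct, so $V_Q$ is invertible. $S$ is (up to sign) the matrix of $\mathfrak{s}=\begin{pmatrix}0&-1\\1&0\end{pmatrix}$ in the Weil representation of $\mathrm{SL}_2(\mathbb{F}_p)$ attached to $Q$, restricted to even functions on $\mathbb{Z}/p\mathbb{Z}$ in the basis $\delta_0,\delta_1+\delta_{p-1},\dots,\delta_r+\delta_{r+1}$. *)

theory Defs
  imports Complex_Main "HOL-Number_Theory.Residues" "Jordan_Normal_Form.Matrix"
begin

definition e2pi :: "real \<Rightarrow> complex" where
  "e2pi x = exp (2 * of_real pi * \<i> * of_real x)"

definition sqrt_eps_p :: "nat \<Rightarrow> complex" where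
  "sqrt_eps_p p = (\<Sum>x<p. e2pi (real (x^2) / real p))"

(* the quadratic form Q(x) = a x^2 / p  (a = 1 gives Q_1, a = c gives Q_2) *)
definition Qf :: "nat \<Rightarrow> int \<Rightarrow> int \<Rightarrow> real" where
  "Qf p a x = real_of_int (a * x^2) / real p"

definition Bf :: "nat \<Rightarrow> int \<Rightarrow> int \<Rightarrow> int \<Rightarrow> real" where
  "Bf p a x y = Qf p a (x + y) - Qf p a x - Qf p a y"

definition S_mat :: "nat \<Rightarrow> int \<Rightarrow> complex mat" where
  "S_mat p a = (let r = (p - 1) div 2; g = sqrt_eps_p p in
     mat (r+1) (r+1) (\<lambda>(j,k).
       if k = 0 then 1 / g
       else if j = 0 then 2 / g
       else (e2pi (- Bf p a (int j) (int k)) + e2pi (Bf p a (int j) (int k))) / g))"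

definition V_mat :: "nat \<Rightarrow> int \<Rightarrow> complex mat" where
  "V_mat p a = (let r = (p - 1) div 2 in
     mat (r+1) (r+1) (\<lambda>(j,k). (e2pi (Qf p a (int j))) ^ k))"

definition ring_Zomega :: "nat \<Rightarrow> complex set" where
  "ring_Zomega p = {of_int m + of_int n * ((1 + sqrt_eps_p p) / 2) | m n. True}"

end

theory Submission
  imports Defs "HOL-Number_Theory.Euler_Criterion" "Jordan_Normal_Form.Determinant"
begin

text \<open>
  Write \<open>\<zeta>\<close> for the primitive root of unity, \<open>g\<close> for the Gauss sum and \<open>\<chi>\<close> for the Legendre symbol.
  It suffices to find a matrix \<open>D\<close> over the ring with \<open>S V = V D\<close>. The entries of column \<open>k\<close> of
  \<open>S V\<close> are quadratic exponential sums. For \<open>k > 0\<close>, completing the square turns them into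
  \<open>\<chi>(ak) \<theta>\<^sub>j\<^sup>m\<close> with \<open>k m \<equiv> -1\<close>, so \<open>D\<close> has in this column the coefficients of \<open>\<chi>(ak) x\<^sup>m\<close> reduced modulo
  the monic polynomial \<open>(x - 1) R(x)\<close>, where \<open>R = \<Prod> (x - \<zeta>\<^bsup>an\<^esup>)\<close> over the quadratic residues \<open>n\<close>. Column
  \<open>0\<close> is \<open>p/g\<close> times the unit vector of \<open>\<theta>\<^sub>0 = 1\<close>, which is interpolated by \<open>(p/g) R(x) / R(1)\<close>.

  The coefficients of \<open>R\<close> are integral combinations of powers of \<open>\<zeta>\<close> which, as functions of \<open>a\<close>, are
  unchanged when \<open>a\<close> is multiplied by a square; this makes them of the form \<open>(A + B \<chi>(a) g)/2\<close> with
  \<open>A \<equiv> B\<close> modulo \<open>2\<close>. The conjugate of \<open>R(1)\<close> is the corresponding product over the non-residues,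
  so \<open>R(1)\<close> has norm \<open>p\<close> and \<open>(p/g) / R(1)\<close> is integral.
\<close>

section \<open>The roots of unity of order p\<close>

lemma e2pi_eq_cis: "e2pi x = cis (2 * pi * x)"
  by (simp add: e2pi_def cis_conv_exp mult_ac)

locale odd_prime =
  fixes p :: nat
  assumes prime_p: "prime p" and odd_p: "odd p"
begin

definition r :: nat where "r = (p - 1) div 2"

definition res :: "int set" where "res = {0..<int p}"

definition z :: "int \<Rightarrow> complex" where "z n = e2pi (of_int n / of_nat p)"

definition chi :: "int \<Rightarrow> int" where "chi n = Legendre n (int p)"

definition g :: complex where "g = sqrt_eps_p p"

lemma p_gt_2: "p > 2"
  using prime_p odd_p prime_ge_2_nat[of p] by (cases "p = 2") auto

lemma p_eq: "p = 2 * r + 1"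
  using odd_p by (auto simp: r_def elim: oddE)

lemma prime_int_p: "prime (int p)"
  using prime_p by simp

lemma finite_res [simp]: "finite res"
  by (simp add: res_def)

lemma mod_in_res [simp]: "n mod int p \<in> res"
  using p_gt_2 by (simp add: res_def)

lemma mod_res [simp]: "n \<in> res \<Longrightarrow> n mod int p = n"
  by (simp add: res_def)

lemma coprime_iff: "coprime n (int p) \<longleftrightarrow> \<not> int p dvd n"
  using prime_int_p by (metis coprime_commute not_coprimeI dvd_refl prime_imp_coprime not_prime_unit)

lemma z_0 [simp]: "z 0 = 1"
  by (simp add: z_def e2pi_def)

lemma z_add: "z (m + n) = z m * z n"
  by (simp add: z_def e2pi_def add_divide_distrib ring_distribs flip: exp_add)

lemma z_power: "z n ^ k = z (n * int k)"
  by (induction k) (simp_all add: z_add ring_distribs)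

lemma z_minus: "z (- n) * z n = 1"
  by (simp flip: z_add)

lemma cnj_z: "cnj (z n) = z (- n)"
  by (simp add: z_def e2pi_eq_cis cis_cnj)

lemma z_eq_1_iff: "z n = 1 \<longleftrightarrow> int p dvd n"
proof
  assume "z n = 1"
  hence "Re (cis (2 * pi * (of_int n / of_nat p))) = 1"
    by (simp add: z_def e2pi_eq_cis)
  hence "cos (2 * pi * (of_int n / of_nat p)) = 1"
    by simp
  then obtain m :: int where "2 * pi * (of_int n / of_nat p) = of_int m * 2 * pi"
    by (subst (asm) cos_one_2pi_int) auto
  hence "real_of_int n = real_of_int m * real p"
    using p_gt_2 by (simp add: field_simps)
  hence "real_of_int n = real_of_int (m * int p)"
    by simp
  hence "n = m * int p"
    by (simp only: of_int_eq_iff)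
  thus "int p dvd n" by simp
next
  assume "int p dvd n"
  then obtain m where "n = int p * m" by (elim dvdE)
  hence "z n = cis (2 * pi * of_int m)"
    using p_gt_2 by (simp add: z_def e2pi_eq_cis)
  thus "z n = 1" by (simp add: cis_multiple_2pi)
qed

lemma z_eq_iff: "z m = z n \<longleftrightarrow> [m = n] (mod int p)"
proof -
  have "z m = z (m - n) * z n"
    by (simp flip: z_add)
  moreover have "z n \<noteq> 0"
    using z_minus[of n] by auto
  ultimately have "z m = z n \<longleftrightarrow> z (m - n) = 1"
    by auto
  thus ?thesis by (simp add: z_eq_1_iff cong_iff_dvd_diff)
qed

lemma z_cong: "[m = n] (mod int p) \<Longrightarrow> z m = z n"
  by (simp add: z_eq_iff)

section \<open>Functions on the residues modulo p and their sums\<close>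

definition periodic :: "(int \<Rightarrow> 'a) \<Rightarrow> bool" where
  "periodic f \<longleftrightarrow> (\<forall>m n. [m = n] (mod int p) \<longrightarrow> f m = f n)"

lemma periodicI: "(\<And>m n. [m = n] (mod int p) \<Longrightarrow> f m = f n) \<Longrightarrow> periodic f"
  by (auto simp: periodic_def)

lemma periodicD: "periodic f \<Longrightarrow> [m = n] (mod int p) \<Longrightarrow> f m = f n"
  by (auto simp: periodic_def)

lemma periodic_mod: "periodic f \<Longrightarrow> f (n mod int p) = f n"
  by (rule periodicD) auto

lemma bij_betw_affine_res:
  assumes "\<not> int p dvd s"
  shows "bij_betw (\<lambda>x. (s * x + t) mod int p) res res"
proof -
  have "inj_on (\<lambda>x. (s * x + t) mod int p) res"
  proof (rule inj_onI)
    fix x y assume "x \<in> res" "y \<in> res" "(s * x + t) mod int p = (s * y + t) mod int p"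
    hence "[s * x + t = s * y + t] (mod int p)"
      by (simp add: cong_def)
    hence "[s * x = s * y] (mod int p)"
      by (simp add: cong_add_rcancel)
    hence "[x = y] (mod int p)"
      using assms by (simp add: cong_mult_lcancel coprime_iff)
    with \<open>x \<in> res\<close> \<open>y \<in> res\<close> show "x = y"
      by (simp add: cong_def)
  qed
  moreover have "(\<lambda>x. (s * x + t) mod int p) ` res \<subseteq> res"
    by auto
  ultimately show ?thesis
    by (simp add: bij_betw_def endo_inj_surj)
qed

lemma sum_res_affine:
  assumes "periodic f" "\<not> int p dvd s"
  shows "(\<Sum>x\<in>res. f (s * x + t)) = sum f res"
proof -
  have "(\<Sum>x\<in>res. f (s * x + t)) = (\<Sum>x\<in>res. f ((s * x + t) mod int p))"
    by (simp add: periodic_mod[OF assms(1)])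
  also have "\<dots> = sum f res"
    by (rule sum.reindex_bij_betw[OF bij_betw_affine_res[OF assms(2)]])
  finally show ?thesis .
qed

lemma p_neq_1 [simp]: "p \<noteq> Suc 0"
  using p_gt_2 by simp

lemma sum_res_shift: "periodic f \<Longrightarrow> (\<Sum>x\<in>res. f (x + t)) = sum f res"
  using sum_res_affine[of f 1 t] by simp

lemma sum_res_scale: "periodic f \<Longrightarrow> \<not> int p dvd s \<Longrightarrow> (\<Sum>x\<in>res. f (s * x)) = sum f res"
  using sum_res_affine[of f s 0] by simp

lemma card_res [simp]: "card res = p"
  by (simp add: res_def)

text \<open>Orthogonality of additive characters: shifting x by 1 multiplies the sum by
  \<open>z u\<close>, so it vanishes unless \<open>z u = 1\<close>.\<close>

lemma sum_z: "(\<Sum>x\<in>res. z (u * x)) = (if int p dvd u then of_nat p else 0)"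
proof (cases "int p dvd u")
  case True
  hence "z (u * x) = 1" for x
    by (simp add: z_eq_1_iff)
  thus ?thesis using True by simp
next
  case False
  have "periodic (\<lambda>x. z (u * x))"
    by (rule periodicI) (auto intro!: z_cong cong_scalar_left)
  hence "(\<Sum>x\<in>res. z (u * (x + 1))) = (\<Sum>x\<in>res. z (u * x))"
    by (rule sum_res_shift)
  hence "z u * (\<Sum>x\<in>res. z (u * x)) = (\<Sum>x\<in>res. z (u * x))"
    by (simp add: ring_distribs z_add sum_distrib_left mult.commute)
  hence "(z u - 1) * (\<Sum>x\<in>res. z (u * x)) = 0"
    by (simp add: ring_distribs)
  moreover have "z u - 1 \<noteq> 0"
    using False by (simp add: z_eq_1_iff)
  ultimately have "(\<Sum>x\<in>res. z (u * x)) = 0"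
    by (simp only: mult_eq_0_iff) simp
  thus ?thesis using False by simp
qed

section \<open>The Legendre symbol\<close>

lemma chi_cases: "chi n = 0 \<and> int p dvd n \<or> (chi n = 1 \<or> chi n = -1) \<and> \<not> int p dvd n"
  by (auto simp: chi_def Legendre_def cong_0_iff)

lemma chi_cong: "[m = n] (mod int p) \<Longrightarrow> chi m = chi n"
  by (simp add: chi_def Legendre_def QuadRes_def cong_def)

lemma chi_eq_0_iff: "chi n = 0 \<longleftrightarrow> int p dvd n"
  using chi_cases[of n] by auto

lemma chi_square: "\<not> int p dvd n \<Longrightarrow> chi (n\<^sup>2) = 1"
  using prime_dvd_power[OF prime_int_p, of n 2]
  by (auto simp: chi_def Legendre_def QuadRes_def cong_0_iff intro: cong_refl)

lemma chi_eq_1D: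
  assumes "chi n = 1"
  obtains y where "[y\<^sup>2 = n] (mod int p)" "\<not> int p dvd y"
proof -
  from assms obtain y where y: "[y\<^sup>2 = n] (mod int p)"
    by (auto simp: chi_def Legendre_def QuadRes_def split: if_splits)
  have "\<not> int p dvd n"
    using assms chi_cases[of n] by auto
  hence "\<not> int p dvd y\<^sup>2"
    using y cong_dvd_iff by blast
  hence "\<not> int p dvd y"
    by (auto simp: power2_eq_square)
  with y that show ?thesis by blast
qed

lemma euler: "[chi n = n ^ r] (mod int p)"
  using euler_criterion[OF prime_p p_gt_2, of n] by (simp add: chi_def r_def)

text \<open>Two integers of absolute value at most 1 differ by at most 2, which is less than p. This
  turns the congruences of Euler's criterion into equations.\<close>

lemma chi_eqI:
  assumes "[chi n = e] (mod int p)" "\<bar>e\<bar> \<le> 1"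
  shows "chi n = e"
proof -
  have "int p dvd chi n - e"
    using assms by (simp add: cong_iff_dvd_diff)
  moreover have "\<bar>chi n - e\<bar> < int p"
    using assms(2) chi_cases[of n] p_gt_2 by auto
  ultimately show ?thesis
    using dvd_imp_le_int[of "chi n - e" "int p"] by fastforce
qed

lemma chi_mult: "chi (m * n) = chi m * chi n"
proof (rule chi_eqI)
  have "[chi m * chi n = m ^ r * n ^ r] (mod int p)"
    by (intro cong_mult euler)
  thus "[chi (m * n) = chi m * chi n] (mod int p)"
    using euler[of "m * n"] by (metis cong_sym cong_trans power_mult_distrib)
  show "\<bar>chi m * chi n\<bar> \<le> 1"
    using chi_cases[of m] chi_cases[of n] by auto
qed

lemma chi_1 [simp]: "chi 1 = 1"
  using chi_square[of 1] by simp

lemma chi_minus_1: "chi (-1) = (-1) ^ r"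
  by (rule chi_eqI[OF euler]) simp

lemma chi_times_self: "\<not> int p dvd n \<Longrightarrow> chi n * chi n = 1"
  using chi_cases[of n] by auto

lemma inverse_mod:
  assumes "\<not> int p dvd n"
  obtains m where "[n * m = 1] (mod int p)" "\<not> int p dvd m"
proof -
  obtain m where m: "[n * m = 1] (mod int p)"
    using assms cong_solve_coprime_int[of n "int p"] by (auto simp: coprime_iff)
  moreover have "\<not> int p dvd m"
  proof
    assume "int p dvd m"
    hence "int p dvd n * m" by simp
    with m have "int p dvd 1"
      using cong_dvd_iff by blast
    thus False by simp
  qed
  ultimately show ?thesis using that by blast
qed

text \<open>A unit that is a square has exactly the roots y and -y, distinct because p is odd; 0 has
  one root and a non-residue has none.\<close>

lemma card_sqrt:
  assumes "n \<in> res"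
  shows "int (card {x \<in> res. x\<^sup>2 mod int p = n}) = 1 + chi n"
proof -
  have eq: "x\<^sup>2 mod int p = n \<longleftrightarrow> [x\<^sup>2 = n] (mod int p)" for x
    using assms by (simp add: cong_def)
  consider "chi n = 0" | "chi n = 1" | "chi n = -1"
    using chi_cases[of n] by auto
  thus ?thesis
  proof cases
    case 1
    hence "n = 0"
      using assms by (auto simp: chi_eq_0_iff dvd_eq_mod_eq_0)
    hence "{x \<in> res. x\<^sup>2 mod int p = n} = {0}"
      using p_gt_2 by (auto simp: mod_eq_0_iff_dvd prime_dvd_power_iff[OF prime_int_p] res_def
          dest: zdvd_imp_le)
    thus ?thesis using 1 by simp
  next
    case 2
    then obtain y where y: "[y\<^sup>2 = n] (mod int p)" "\<not> int p dvd y"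
      by (rule chi_eq_1D)
    have "{x \<in> res. x\<^sup>2 mod int p = n} = {y mod int p, (- y) mod int p}"
    proof (intro equalityI subsetI)
      fix x assume "x \<in> {x \<in> res. x\<^sup>2 mod int p = n}"
      hence x: "x \<in> res" "[x\<^sup>2 = n] (mod int p)"
        by (auto simp: eq)
      hence "[x\<^sup>2 = y\<^sup>2] (mod int p)"
        using y cong_sym cong_trans by blast
      hence "int p dvd (x - y) * (x + y)"
        by (simp add: cong_iff_dvd_diff power2_eq_square algebra_simps)
      hence "[x = y] (mod int p) \<or> [x = - y] (mod int p)"
        using prime_int_p by (simp add: prime_dvd_mult_iff cong_iff_dvd_diff)
      thus "x \<in> {y mod int p, (- y) mod int p}"
        using x(1) by (auto simp: cong_def)
    next
      fix x assume "x \<in> {y mod int p, (- y) mod int p}"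
      hence "x \<in> res" "[x = y] (mod int p) \<or> [x = - y] (mod int p)"
        by auto
      moreover from this(2) have "[x\<^sup>2 = y\<^sup>2] (mod int p)"
        using cong_pow[of x "-y" "int p" 2] cong_pow[of x y "int p" 2] by auto
      ultimately show "x \<in> {x \<in> res. x\<^sup>2 mod int p = n}"
        using y cong_trans by (auto simp: eq)
    qed
    moreover have "y mod int p \<noteq> (- y) mod int p"
    proof
      assume "y mod int p = (- y) mod int p"
      hence "int p dvd 2 * y"
        by (simp add: mod_eq_dvd_iff)
      hence "int p dvd 2"
        using y prime_int_p by (simp add: prime_dvd_mult_iff)
      thus False using p_gt_2 zdvd_imp_le[of "int p" 2] by simp
    qed
    ultimately show ?thesis using 2 by simp
  next
    case 3
    hence "{x \<in> res. x\<^sup>2 mod int p = n} = {}"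
      by (auto simp: eq chi_def Legendre_def QuadRes_def split: if_splits)
    thus ?thesis using 3 by (simp only: card.empty)
  qed
qed

section \<open>Quadratic Gauss sums\<close>

definition G :: "int \<Rightarrow> complex" where "G u = (\<Sum>x\<in>res. z (u * x\<^sup>2))"

lemma g_eq_G: "g = G 1"
proof -
  have "g = (\<Sum>x<p. z ((int x)\<^sup>2))"
    by (simp add: g_def sqrt_eps_p_def z_def)
  also have "\<dots> = (\<Sum>x\<in>res. z (x\<^sup>2))"
    by (rule sum.reindex_bij_witness[of _ nat int]) (auto simp: res_def)
  finally show ?thesis by (simp add: G_def)
qed

text \<open>Grouping the x by their squares gives n the weight 1 + \<open>chi n\<close>, and the
  constant 1 contributes nothing by orthogonality.\<close>

lemma G_eq_sum_chi:
  assumes "\<not> int p dvd u"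
  shows "G u = (\<Sum>n\<in>res. of_int (chi n) * z (u * n))"
proof -
  have "G u = (\<Sum>x\<in>res. z (u * (x\<^sup>2 mod int p)))"
    unfolding G_def by (intro sum.cong refl z_cong cong_scalar_left) auto
  also have "\<dots> = (\<Sum>n\<in>res. \<Sum>x\<in>{x \<in> res. x\<^sup>2 mod int p = n}. z (u * (x\<^sup>2 mod int p)))"
    by (rule sum.group[symmetric]) auto
  also have "\<dots> = (\<Sum>n\<in>res. of_int (1 + chi n) * z (u * n))"
  proof (rule sum.cong)
    fix n assume "n \<in> res"
    have "(\<Sum>x\<in>{x \<in> res. x\<^sup>2 mod int p = n}. z (u * (x\<^sup>2 mod int p)))
        = of_int (int (card {x \<in> res. x\<^sup>2 mod int p = n})) * z (u * n)"
      by simp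
    thus "(\<Sum>x\<in>{x \<in> res. x\<^sup>2 mod int p = n}. z (u * (x\<^sup>2 mod int p)))
        = of_int (1 + chi n) * z (u * n)"
      using card_sqrt[OF \<open>n \<in> res\<close>] by simp
  qed auto
  also have "\<dots> = (\<Sum>n\<in>res. of_int (chi n) * z (u * n))"
    using sum_z[of u] assms by (simp add: ring_distribs sum.distrib)
  finally show ?thesis .
qed

text \<open>In the form with \<open>chi\<close>, substituting u n for n pulls out the factor
  \<open>chi u\<close>, which is its own inverse.\<close>

lemma G_eq_chi_g:
  assumes "\<not> int p dvd u"
  shows "G u = of_int (chi u) * g"
proof -
  have "periodic (\<lambda>n. of_int (chi n) * z n)"
    by (rule periodicI) (simp add: z_cong chi_cong)
  from sum_res_scale[OF this assms]
  have "g = (\<Sum>n\<in>res. of_int (chi (u * n)) * z (u * n))"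
    by (simp add: g_eq_G G_eq_sum_chi)
  also have "\<dots> = of_int (chi u) * G u"
    using assms by (simp add: chi_mult G_eq_sum_chi sum_distrib_left mult.assoc)
  finally have "of_int (chi u) * g = of_int (chi u * chi u) * G u"
    by simp
  thus ?thesis using assms by (simp add: chi_times_self)
qed

text \<open>After the substitution x = t + y the difference of the squares is linear in y, so the
  sum over y leaves only t = 0.\<close>

lemma g_times_cnj: "g * cnj g = of_nat p"
proof -
  have "cnj g * g = (\<Sum>y\<in>res. \<Sum>x\<in>res. z (x\<^sup>2 - y\<^sup>2))"
    by (simp add: g_eq_G G_def cnj_z sum_product flip: z_add)
  also have "\<dots> = (\<Sum>y\<in>res. \<Sum>t\<in>res. z ((t + y)\<^sup>2 - y\<^sup>2))"
    by (intro sum.cong refl sum_res_shift[symmetric] periodicI z_cong cong_diff cong_pow) auto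
  also have "\<dots> = (\<Sum>t\<in>res. \<Sum>y\<in>res. z (t\<^sup>2) * z (2 * t * y))"
    by (subst sum.swap) (simp add: power2_eq_square algebra_simps flip: z_add)
  also have "\<dots> = (\<Sum>t\<in>res. if t = 0 then of_nat p else 0)"
  proof (rule sum.cong)
    fix t assume t: "t \<in> res"
    have "\<not> int p dvd 2"
      using p_gt_2 zdvd_imp_le[of "int p" 2] by auto
    hence "int p dvd 2 * t \<longleftrightarrow> t = 0"
      using t prime_int_p by (auto simp: prime_dvd_mult_iff res_def dest: zdvd_imp_le)
    thus "(\<Sum>y\<in>res. z (t\<^sup>2) * z (2 * t * y)) = (if t = 0 then of_nat p else 0)"
      by (simp add: sum_z flip: sum_distrib_left)
  qed auto
  also have "\<dots> = of_nat p"
    using p_gt_2 by (simp add: res_def)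
  finally show ?thesis by (simp add: mult.commute)
qed

text \<open>The conjugate of \<open>g\<close> is \<open>G (-1)\<close>, that is
  \<open>chi (-1) * g\<close>, so the square can be read off from the absolute value.\<close>

lemma g_square: "g * g = of_int (chi (-1) * int p)"
proof -
  have "cnj g = G (-1)"
    by (simp add: g_eq_G G_def cnj_z)
  also have "\<dots> = of_int (chi (-1)) * g"
    by (rule G_eq_chi_g) simp
  finally have "of_int (chi (-1)) * (g * g) = of_nat p"
    using g_times_cnj by (simp add: mult_ac)
  hence "of_int (chi (-1) * chi (-1)) * (g * g) = of_int (chi (-1) * int p)"
    by (simp add: mult.assoc)
  moreover have "chi (-1) * chi (-1) = 1"
    by (rule chi_times_self) simp
  ultimately show ?thesis by simp
qed

lemma g_nonzero: "g \<noteq> 0"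
  using g_times_cnj p_gt_2 by auto

section \<open>Integral exponential sums invariant under squares\<close>

lemma nonresidue_exists: "\<exists>b. chi b = -1"
proof (rule ccontr)
  assume "\<not> (\<exists>b. chi b = -1)"
  hence chi: "chi n = (if n = 0 then 0 else 1)" if "n \<in> res" for n
    using that chi_cases[of n] by (auto simp: dvd_eq_mod_eq_0)
  have 0: "0 \<in> res"
    using p_gt_2 by (simp add: res_def)
  \<comment> \<open>If all units were squares, \<open>g\<close> would be the sum of the nontrivial
    roots of unity, which is -1; but its square is p up to sign.\<close>
  have "g = (\<Sum>n\<in>res. z n - (if n = 0 then 1 else 0))"
    by (simp add: g_eq_G G_eq_sum_chi chi if_distrib cong: sum.cong)
       (intro sum.cong; simp)
  also have "\<dots> = -1"
    using sum_z[of 1] 0 by (simp add: sum_subtractf)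
  finally have "of_int (chi (-1) * int p) = complex_of_int 1"
    using g_square by simp
  hence "chi (-1) * int p = 1"
    by (simp only: of_int_eq_iff)
  thus False
    using p_gt_2 by (simp add: zmult_eq_1_iff)
qed

text \<open>An integral combination of roots of unity is kept together with its Galois conjugates,
  which are its values at the units u. Periodicity of the coefficients lets their index be shifted
  without reduction.\<close>

definition trig :: "(int \<Rightarrow> complex) set" where
  "trig = {F. \<exists>c :: int \<Rightarrow> int. periodic c \<and> (\<forall>u. F u = (\<Sum>n\<in>res. of_int (c n) * z (u * n)))}"

lemma trigI:
  assumes "periodic c" "\<And>u. F u = (\<Sum>n\<in>res. of_int (c n) * z (u * n))"
  shows "F \<in> trig"
  using assms unfolding trig_def by blast

lemma trig_0: "(\<lambda>_. 0) \<in> trig"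
  by (rule trigI[of "\<lambda>_. 0"]) (auto simp: periodic_def)

lemma trig_1: "(\<lambda>_. 1) \<in> trig"
proof (rule trigI)
  show "periodic (\<lambda>n. if int p dvd n then 1 else 0 :: int)"
    by (rule periodicI) (simp add: cong_dvd_iff)
  fix u
  have "(\<Sum>n\<in>res. of_int (if int p dvd n then 1 else 0) * z (u * n)) =
        (\<Sum>n\<in>res. if n = 0 then 1 else 0)"
    by (rule sum.cong) (auto simp: dvd_eq_mod_eq_0)
  also have "\<dots> = 1"
    using p_gt_2 by (simp add: res_def)
  finally show "1 = (\<Sum>n\<in>res. of_int (if int p dvd n then 1 else 0) * z (u * n))"
    by simp
qed

text \<open>Multiplication by \<open>z (u * m)\<close> shifts the coefficients by m. The form is
  that of the recursion for the coefficients of a product with one more factor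
  \<open>[:- z (u * m), 1:]\<close>.\<close>

lemma trig_diff_shift:
  assumes "F \<in> trig" "H \<in> trig"
  shows "(\<lambda>u. F u - z (u * m) * H u) \<in> trig"
proof -
  from assms obtain c d :: "int \<Rightarrow> int" where
    c: "periodic c" "\<And>u. F u = (\<Sum>n\<in>res. of_int (c n) * z (u * n))" and
    d: "periodic d" "\<And>u. H u = (\<Sum>n\<in>res. of_int (d n) * z (u * n))"
    unfolding trig_def by blast
  have d': "periodic (\<lambda>n. d (n - m))"
    by (intro periodicI periodicD[OF d(1)] cong_diff) auto
  show ?thesis
  proof (rule trigI)
    show "periodic (\<lambda>n. c n - d (n - m))"
      using c(1) d' by (simp add: periodic_def)
    fix u
    have "periodic (\<lambda>n. of_int (d (n - m)) * z (u * n))"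
      by (intro periodicI arg_cong2[of _ _ _ _ "(*)"] arg_cong[of _ _ of_int] periodicD[OF d']
          z_cong cong_scalar_left)
    from sum_res_shift[OF this, of m]
    have "z (u * m) * H u = (\<Sum>n\<in>res. of_int (d (n - m)) * z (u * n))"
      by (simp add: d(2) sum_distrib_left ring_distribs z_add mult_ac)
    thus "F u - z (u * m) * H u = (\<Sum>n\<in>res. of_int (c n - d (n - m)) * z (u * n))"
      by (simp add: c(2) sum_subtractf ring_distribs)
  qed
qed

lemma trig_coeff_prod:
  assumes "finite X"
  shows "(\<lambda>u. coeff (\<Prod>n\<in>X. [:- z (u * n), 1:]) i) \<in> trig"
  using assms
proof (induction X arbitrary: i rule: finite_induct)
  case empty
  show ?case
    by (cases "i = 0") (simp_all add: trig_0 trig_1)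
next
  case (insert m X)
  show ?case
  proof (cases i)
    case 0
    thus ?thesis
      using insert trig_diff_shift[OF trig_0 insert.IH[of 0], of m] by simp
  next
    case (Suc k)
    thus ?thesis
      using insert trig_diff_shift[OF insert.IH[of k] insert.IH[of "Suc k"], of m] by simp
  qed
qed

lemma trig_prod:
  assumes "finite X"
  shows "(\<lambda>u. \<Prod>n\<in>X. 1 - z (u * n)) \<in> trig"
  using assms
proof (induction X rule: finite_induct)
  case (insert m X)
  thus ?case
    using trig_diff_shift[OF insert.IH insert.IH, of m] by (simp add: algebra_simps)
qed (simp add: trig_1)

text \<open>Invariance of the values passes to the coefficients by Fourier inversion, so a coefficient
  depends only on the quadratic character of its index.\<close>

lemma trig_invariant:
  assumes "F \<in> trig" and inv: "\<And>u s. chi s = 1 \<Longrightarrow> F (s * u) = F u"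
  obtains A B :: int where "even (A - B)"
    "\<And>u. \<not> int p dvd u \<Longrightarrow> F u = (of_int A + of_int (B * chi u) * g) / 2"
proof -
  from assms(1) obtain c :: "int \<Rightarrow> int" where
    c: "periodic c" "\<And>u. F u = (\<Sum>n\<in>res. of_int (c n) * z (u * n))"
    unfolding trig_def by blast
  have inversion: "of_nat p * of_int (c m) = (\<Sum>u\<in>res. F u * z (- u * m))" for m
  proof -
    have "(\<Sum>u\<in>res. F u * z (- u * m)) = (\<Sum>u\<in>res. \<Sum>n\<in>res. of_int (c n) * z ((n - m) * u))"
      by (simp add: c(2) sum_distrib_right mult.assoc flip: z_add) (simp add: algebra_simps)
    also have "\<dots> = (\<Sum>n\<in>res. of_int (c n) * (\<Sum>u\<in>res. z ((n - m) * u)))"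
      by (subst sum.swap) (simp add: sum_distrib_left)
    also have "\<dots> = (\<Sum>n\<in>res. if n = m mod int p then of_int (c n) * of_nat p else 0)"
    proof (rule sum.cong)
      fix n assume "n \<in> res"
      hence "int p dvd n - m \<longleftrightarrow> n = m mod int p"
        by (metis mod_eq_dvd_iff mod_res)
      thus "of_int (c n) * (\<Sum>u\<in>res. z ((n - m) * u)) =
          (if n = m mod int p then of_int (c n) * of_nat p else 0)"
        by (simp add: sum_z)
    qed auto
    also have "\<dots> = of_nat p * of_int (c m)"
      by (simp add: periodic_mod[OF c(1)])
    finally show ?thesis by simp
  qed
  \<comment> \<open>Inversion at \<open>s * m\<close> is inversion at m with u replaced by
    \<open>s * u\<close>, and the sum over all u does not see this change.\<close>
  have c_scale: "c (s * m) = c m" if s: "chi s = 1" for s m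
  proof -
    have "\<not> int p dvd s"
      using s chi_cases[of s] by auto
    moreover have "periodic (\<lambda>u. F u * z (- u * m))"
      unfolding c(2)
      by (intro periodicI arg_cong2[of _ _ _ _ "(*)"] sum.cong refl z_cong cong_mult)
         (auto simp: cong_minus_minus_iff)
    ultimately have "(\<Sum>u\<in>res. F (s * u) * z (- (s * u) * m)) = (\<Sum>u\<in>res. F u * z (- u * m))"
      by (intro sum_res_scale)
    hence "of_nat p * of_int (c (s * m)) = of_nat p * complex_of_int (c m)"
      unfolding inversion by (simp add: inv[OF s]) (simp add: mult_ac)
    thus ?thesis using p_gt_2 by simp
  qed
  \<comment> \<open>The quotient of two units of equal character is a square, so the scaling
    invariance applies to it.\<close>
  have c_chi: "c m = c n" if mn: "chi m = chi n" "\<not> int p dvd n" for m n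
  proof -
    obtain n' where n': "[n * n' = 1] (mod int p)"
      using inverse_mod[OF mn(2)] by blast
    have "chi (m * n') = chi (n * n')"
      by (simp add: chi_mult mn)
    hence "chi (m * n') = 1"
      using chi_cong[OF n'] by simp
    hence "c n = c (m * n' * n)"
      by (simp add: c_scale)
    also have "\<dots> = c m"
      using cong_scalar_left[OF n', of m] by (intro periodicD[OF c(1)]) (simp add: mult_ac)
    finally show ?thesis by simp
  qed
  obtain b where b: "chi b = -1"
    using nonresidue_exists by blast
  hence b': "\<not> int p dvd b"
    using chi_cases[of b] by auto
  \<comment> \<open>On the units c has the value \<open>c 1\<close> at residues and
    \<open>c b\<close> at non-residues, so \<open>2 * c\<close> is there the combination of 1 and
    \<open>chi\<close> with these coefficients; the index 0 needs a correction.\<close>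
  define \<alpha> \<beta> where "\<alpha> = c 1 + c b" and "\<beta> = c 1 - c b"
  have c2: "2 * c n = \<alpha> + \<beta> * chi n + (if n = 0 then 2 * c 0 - \<alpha> else 0)" if n: "n \<in> res" for n
  proof -
    consider "n = 0" | "chi n = 1" "n \<noteq> 0" | "chi n = -1" "n \<noteq> 0"
      using chi_cases[of n] n by (auto simp: dvd_eq_mod_eq_0)
    thus ?thesis
    proof cases
      case 1
      thus ?thesis using chi_eq_0_iff[of 0] by simp
    next
      case 2
      thus ?thesis using c_chi[of n 1] by (simp add: \<alpha>_def \<beta>_def)
    next
      case 3
      thus ?thesis using c_chi[of n b] b b' by (simp add: \<alpha>_def \<beta>_def)
    qed
  qed
  have "F u = (of_int (2 * c 0 - \<alpha>) + of_int (\<beta> * chi u) * g) / 2" if u: "\<not> int p dvd u" for u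
  proof -
    have 0: "0 \<in> res"
      using p_gt_2 by (simp add: res_def)
    have "2 * F u = (\<Sum>n\<in>res. of_int (2 * c n) * z (u * n))"
      by (simp add: c(2) sum_distrib_left mult.assoc)
    also have "\<dots> = (\<Sum>n\<in>res. of_int \<alpha> * z (u * n) + of_int \<beta> * (of_int (chi n) * z (u * n))
        + (if n = 0 then of_int (2 * c 0 - \<alpha>) else 0))"
      by (intro sum.cong refl, subst c2) (auto simp: ring_distribs)
    \<comment> \<open>The constant part will vanish by orthogonality, the part with
      \<open>chi\<close> is a Gauss sum, and the correction at 0 survives as the rational
      part.\<close>
    also have "\<dots> = of_int \<alpha> * (\<Sum>n\<in>res. z (u * n)) + of_int \<beta> * G u + of_int (2 * c 0 - \<alpha>)"
      using 0 u by (simp add: sum.distrib sum_distrib_left G_eq_sum_chi)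
    also have "\<dots> = of_int (2 * c 0 - \<alpha>) + of_int (\<beta> * chi u) * g"
      using u by (simp add: sum_z G_eq_chi_g)
    finally show ?thesis by (simp add: mult.commute)
  qed
  moreover have "even (2 * c 0 - \<alpha> - \<beta>)"
    by (simp add: \<alpha>_def \<beta>_def)
  ultimately show ?thesis using that by blast
qed

section \<open>The polynomial of the quadratic residues and the ring of integers\<close>

definition Sq :: "int set" where "Sq = {n \<in> res. chi n = 1}"

lemma finite_Sq [simp]: "finite Sq"
  by (simp add: Sq_def)

text \<open>Multiplication by s permutes the residue classes and multiplies the character by
  \<open>chi s\<close>, so it carries the squares onto the class of s.\<close>

lemma prod_Sq_scale:
  assumes "periodic f" "\<not> int p dvd s"
  shows "(\<Prod>n\<in>Sq. f (s * n)) = (\<Prod>n\<in>{n \<in> res. chi n = chi s}. f n)"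
proof -
  define h where "h = (\<lambda>n. (s * n) mod int p)"
  have bij: "bij_betw h res res"
    using bij_betw_affine_res[OF assms(2), of 0] by (simp add: h_def)
  have chi_h: "chi (h n) = chi s * chi n" for n
    by (simp add: h_def chi_mult[symmetric] chi_cong)
  have "h ` Sq = {n \<in> res. chi n = chi s}"
  proof (intro equalityI subsetI)
    fix m assume m: "m \<in> {n \<in> res. chi n = chi s}"
    then obtain n where n: "n \<in> res" "m = h n"
      using bij by (auto simp: bij_betw_def)
    hence "chi s * chi n = chi s"
      using m chi_h[of n] by simp
    hence "chi n = 1"
      using assms(2) chi_eq_0_iff[of s] by simp
    thus "m \<in> h ` Sq" using n by (auto simp: Sq_def)
  qed (auto simp: Sq_def chi_h, auto simp: h_def)
  hence "bij_betw h Sq {n \<in> res. chi n = chi s}"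
    using bij by (intro bij_betw_subset[OF bij]) (auto simp: Sq_def)
  from prod.reindex_bij_betw[OF this, of f] show ?thesis
    by (simp add: h_def periodic_mod[OF assms(1)])
qed

definition Rp :: "int \<Rightarrow> complex poly" where "Rp u = (\<Prod>n\<in>Sq. [:- z (u * n), 1:])"

definition T :: "int \<Rightarrow> complex" where "T u = (\<Prod>n\<in>Sq. 1 - z (u * n))"

lemma poly_Rp_1: "poly (Rp u) 1 = T u"
  by (simp add: Rp_def T_def poly_prod)

lemma Rp_invariant:
  assumes "chi s = 1"
  shows "Rp (s * u) = Rp u"
proof -
  have "periodic (\<lambda>n. [:- z (u * n), 1:])"
    by (rule periodicI) (auto intro!: z_cong cong_scalar_left)
  moreover have "\<not> int p dvd s"
    using assms chi_cases[of s] by auto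
  ultimately show ?thesis
    using prod_Sq_scale[of "\<lambda>n. [:- z (u * n), 1:]" s] assms by (simp add: Rp_def Sq_def mult_ac)
qed

text \<open>This is the form in which \<open>trig_invariant\<close> delivers its values, and in
  which conjugation merely changes the sign of B.\<close>

lemma ring_Zomega_iff:
  "x \<in> ring_Zomega p \<longleftrightarrow> (\<exists>A B. even (A - B) \<and> x = (of_int A + of_int B * g) / 2)"
proof
  assume "x \<in> ring_Zomega p"
  then obtain m n where "x = of_int m + of_int n * ((1 + g) / 2)"
    by (auto simp: ring_Zomega_def g_def)
  hence "x = (of_int (2 * m + n) + of_int n * g) / 2"
    by (simp add: field_simps)
  thus "\<exists>A B. even (A - B) \<and> x = (of_int A + of_int B * g) / 2"
    by (intro exI[of _ "2 * m + n"] exI[of _ n]) auto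
next
  assume "\<exists>A B. even (A - B) \<and> x = (of_int A + of_int B * g) / 2"
  then obtain A B where "even (A - B)" and x: "x = (of_int A + of_int B * g) / 2"
    by blast
  then obtain m where "A - B = 2 * m" by (elim evenE)
  hence "A = B + 2 * m" by simp
  hence "x = of_int m + of_int B * ((1 + g) / 2)"
    unfolding x by (simp add: field_simps)
  thus "x \<in> ring_Zomega p"
    by (auto simp: ring_Zomega_def g_def)
qed

lemma Zomega_of_int: "of_int m \<in> ring_Zomega p"
  unfolding ring_Zomega_iff by (intro exI[of _ "2 * m"] exI[of _ 0]) auto

lemma Zomega_diff:
  assumes "x \<in> ring_Zomega p" "y \<in> ring_Zomega p"
  shows "x - y \<in> ring_Zomega p"
proof -
  from assms obtain m n m' n' where "x = of_int m + of_int n * ((1 + g) / 2)"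
    "y = of_int m' + of_int n' * ((1 + g) / 2)"
    by (auto simp: ring_Zomega_def g_def)
  hence "x - y = of_int (m - m') + of_int (n - n') * ((1 + g) / 2)"
    by (simp add: left_diff_distrib)
  thus ?thesis unfolding ring_Zomega_def g_def by blast
qed

text \<open>This makes (1 + g)/2 a root of the integral polynomial x^2 - x - q, whence the closure
  of the ring under multiplication.\<close>

lemma eps_p_cong_1: "\<exists>q. chi (-1) * int p = 1 + 4 * q"
proof (cases "even r")
  case True
  then obtain k where "r = 2 * k" by (elim evenE)
  moreover from this have "int p = 1 + 4 * int k"
    using p_eq by linarith
  ultimately have "chi (-1) * int p = 1 + 4 * int k"
    by (simp add: chi_minus_1)
  thus ?thesis ..
next
  case False
  then obtain k where "r = 2 * k + 1" by (elim oddE)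
  moreover from this have "int p = 3 + 4 * int k"
    using p_eq by linarith
  ultimately have "chi (-1) * int p = 1 + 4 * (- int k - 1)"
    by (simp add: chi_minus_1)
  thus ?thesis ..
qed

lemma Zomega_mult:
  assumes "x \<in> ring_Zomega p" "y \<in> ring_Zomega p"
  shows "x * y \<in> ring_Zomega p"
proof -
  define \<omega> where "\<omega> = (1 + g) / 2"
  obtain q where q: "chi (-1) * int p = 1 + 4 * q"
    using eps_p_cong_1 by blast
  have \<omega>: "\<omega> * \<omega> = \<omega> + of_int q"
  proof -
    have "\<omega> * \<omega> = (1 + 2 * g + g * g) / 4"
      by (simp add: \<omega>_def field_simps)
    also have "\<dots> = (2 + 2 * g + 4 * of_int q) / 4"
      unfolding g_square q by simp
    finally show ?thesis by (simp add: \<omega>_def add_divide_distrib)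
  qed
  from assms obtain m n m' n' where "x = of_int m + of_int n * \<omega>" "y = of_int m' + of_int n' * \<omega>"
    by (auto simp: ring_Zomega_def g_def \<omega>_def)
  hence "x * y = of_int (m * m') + of_int (m * n' + n * m') * \<omega> + of_int (n * n') * (\<omega> * \<omega>)"
    by (simp add: algebra_simps)
  also have "\<dots> = of_int (m * m' + n * n' * q) + of_int (m * n' + n * m' + n * n') * \<omega>"
    unfolding \<omega> by (simp add: algebra_simps)
  finally show ?thesis unfolding ring_Zomega_def g_def \<omega>_def by blast
qed

text \<open>Each coefficient is an integral exponential sum in u that is invariant under squares. As
  \<open>chi u\<close> is odd, the parity condition survives the factor
  \<open>chi u\<close>.\<close>

lemma coeff_Rp_Zomega:
  assumes "\<not> int p dvd u"
  shows "coeff (Rp u) i \<in> ring_Zomega p"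
proof -
  obtain A B where AB: "even (A - B)"
    "\<And>u. \<not> int p dvd u \<Longrightarrow> coeff (Rp u) i = (of_int A + of_int (B * chi u) * g) / 2"
    using trig_invariant[of "\<lambda>u. coeff (Rp u) i"] trig_coeff_prod[OF finite_Sq] Rp_invariant
    unfolding Rp_def by metis
  have "odd (chi u)"
    using chi_cases[of u] assms by auto
  hence "even (A - B * chi u)"
    using AB(1) by simp
  thus ?thesis
    using AB(2)[OF assms] unfolding ring_Zomega_iff by blast
qed

section \<open>The norm of the value at 1\<close>

lemma prod_one_minus_z: "(\<Prod>n\<in>res - {0}. 1 - z n) = of_nat p"
proof -
  define f where "f = (\<Sum>i<p. monom (1 :: complex) i)"
  define h where "h = (\<Prod>x\<in>z ` (res - {0}). [:- x, 1:])"
  have inj: "inj_on z (res - {0})"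
    by (rule inj_onI) (auto simp: z_eq_iff cong_def)
  have 0: "0 \<in> res"
    using p_gt_2 by (simp add: res_def)
  have card: "card (z ` (res - {0})) = p - 1"
    using 0 by (simp add: card_image[OF inj])
  have deg_h: "degree h = p - 1"
    using card by (simp add: h_def degree_prod_eq_sum_degree)
  \<comment> \<open>Both are monic of degree p - 1 and agree at the p - 1 nontrivial roots of unity;
    the claim compares their values at 1.\<close>
  have "f = h"
  proof (rule poly_eqI_degree_lead_coeff[where A = "z ` (res - {0})" and n = "p - 1"])
    show "degree f \<le> p - 1"
      unfolding f_def by (rule degree_sum_le) (auto intro: order_trans[OF degree_monom_le])
    show "degree h \<le> p - 1" by (simp add: deg_h)
    show "p - 1 \<le> card (z ` (res - {0}))" by (simp add: card)
    have "coeff h (p - 1) = 1"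
      using lead_coeff_prod[of "\<lambda>x. [:- x, 1:]" "z ` (res - {0})"] deg_h by (simp add: h_def)
    thus "coeff f (p - 1) = coeff h (p - 1)"
      using p_gt_2 by (simp add: f_def coeff_sum)
    fix x assume x: "x \<in> z ` (res - {0})"
    then obtain n where n: "n \<in> res" "n \<noteq> 0" "x = z n" by auto
    have "x \<noteq> 1"
      using n by (auto simp: z_eq_1_iff dvd_eq_mod_eq_0)
    moreover have "x ^ p = 1"
      by (simp add: n z_power z_eq_1_iff)
    ultimately have "poly f x = 0"
      by (simp add: f_def poly_sum poly_monom sum_gp_strict)
    moreover have "poly h x = 0"
      using x by (simp add: h_def poly_prod)
    ultimately show "poly f x = poly h x" by simp
  qed
  hence "poly f 1 = poly h 1" by simp
  thus ?thesis
    by (simp add: f_def h_def poly_sum poly_monom poly_prod prod.reindex[OF inj])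
qed

text \<open>The two products run over the units of character \<open>chi u\<close> and
  \<open>- chi u\<close>, which together are all units.\<close>

lemma T_conj:
  assumes "\<not> int p dvd u" "chi b = -1"
  shows "T u * T (b * u) = of_nat p"
proof -
  have per: "periodic (\<lambda>n. 1 - z n)"
    by (rule periodicI) (simp add: z_cong)
  have "\<not> int p dvd b * u"
    using assms chi_cases[of b] prime_int_p by (auto simp: prime_dvd_mult_iff)
  hence "T (b * u) = (\<Prod>n\<in>{n \<in> res. chi n = - chi u}. 1 - z n)"
    using prod_Sq_scale[OF per, of "b * u"] assms by (simp add: T_def chi_mult)
  moreover have "T u = (\<Prod>n\<in>{n \<in> res. chi n = chi u}. 1 - z n)"
    using prod_Sq_scale[OF per assms(1)] by (simp add: T_def)
  moreover have "{n \<in> res. chi n = chi u} \<union> {n \<in> res. chi n = - chi u} = res - {0}"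
    using chi_cases[of u] assms(1) chi_eq_0_iff[of 0]
    by (auto simp: dvd_eq_mod_eq_0) (metis chi_cases dvd_eq_mod_eq_0 mod_res)+
  moreover have "{n \<in> res. chi n = chi u} \<inter> {n \<in> res. chi n = - chi u} = {}"
    using chi_cases[of u] assms(1) by auto
  ultimately show ?thesis
    by (simp add: prod_one_minus_z flip: prod.union_disjoint)
qed

lemma p_over_g: "of_nat p / g = of_int (chi (-1)) * g"
proof -
  have "of_int (chi (-1)) * (g * g) = of_int (chi (-1) * chi (-1)) * of_nat p"
    unfolding g_square by simp
  also have "chi (-1) * chi (-1) = 1"
    by (rule chi_times_self) simp
  finally show ?thesis
    using g_nonzero by (simp add: field_simps)
qed

text \<open>The norm of \<open>T u\<close> is \<open>p\<close>, which is also the norm of \<open>g\<close> up to sign; as \<open>p\<close> ramifies, the two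
  differ by a unit.\<close>

lemma p_over_g_T_Zomega:
  assumes u: "\<not> int p dvd u"
  shows "T u \<noteq> 0" "of_nat p / g / T u \<in> ring_Zomega p"
proof -
  obtain A B where AB: "even (A - B)"
    "\<And>u. \<not> int p dvd u \<Longrightarrow> T u = (of_int A + of_int (B * chi u) * g) / 2"
    using trig_invariant[of T] trig_prod[OF finite_Sq] Rp_invariant
    unfolding T_def[abs_def] poly_Rp_1[symmetric, unfolded T_def] by metis
  obtain b where b: "chi b = -1"
    using nonresidue_exists by blast
  have bu: "\<not> int p dvd b * u"
    using u b chi_cases[of b] prime_int_p by (auto simp: prime_dvd_mult_iff)
  have norm: "T u * T (b * u) = of_nat p"
    using T_conj[OF u b] .
  thus nz: "T u \<noteq> 0"
    using p_gt_2 by auto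
  define D where "D = B * chi u"
  have odd: "odd (chi u)"
    using chi_cases[of u] u by auto
  have Tu: "T u = (of_int A + of_int D * g) / 2"
    using AB(2)[OF u] by (simp add: D_def)
  \<comment> \<open>Passing from u to \<open>b * u\<close> flips the character and thus conjugates
    the value.\<close>
  have Tbu: "T (b * u) = (of_int A - of_int D * g) / 2"
    using AB(2)[OF bu] b by (simp add: D_def chi_mult)
  have "4 * complex_of_nat p = of_int A * of_int A - of_int D * of_int D * (g * g)"
    unfolding norm[symmetric] Tu Tbu by (simp add: field_simps)
  hence "complex_of_int (4 * int p) = of_int (A * A - D * D * (chi (-1) * int p))"
    unfolding g_square by simp
  hence "4 * int p = A * A - D * D * (chi (-1) * int p)"
    by (simp only: of_int_eq_iff)
  \<comment> \<open>The norm equation forces p to divide A, so that division by \<open>g\<close>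
    leaves integers A' and D as half-coordinates.\<close>
  hence "A * A = int p * (4 + D * D * chi (-1))"
    by (simp add: algebra_simps)
  hence "int p dvd A * A" by simp
  hence "int p dvd A"
    using prime_int_p by (simp add: prime_dvd_mult_iff)
  then obtain A' where A': "A = int p * A'" by (elim dvdE)
  have "of_nat p / g / T u = T (b * u) / g"
    using nz g_nonzero unfolding norm[symmetric] by (simp add: field_simps)
  also have "\<dots> = (of_int A' * (of_nat p / g) - of_int D) / 2"
    using g_nonzero by (simp add: Tbu A' field_simps)
  also have "\<dots> = (of_int (- D) + of_int (A' * chi (-1)) * g) / 2"
    by (simp add: p_over_g)
  finally have "of_nat p / g / T u = (of_int (- D) + of_int (A' * chi (-1)) * g) / 2" .
  \<comment> \<open>As p and the values of \<open>chi\<close> at units are odd, D, B, A and A' all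
    have the same parity.\<close>
  moreover have "even (- D - A' * chi (-1))"
    using AB(1) odd odd_p chi_minus_1 by (auto simp: A' D_def)
  ultimately show "of_nat p / g / T u \<in> ring_Zomega p"
    unfolding ring_Zomega_iff by blast
qed

end

section \<open>Vandermonde matrices and reduction modulo a monic polynomial\<close>

lemma poly_eq_sum_coeff:
  fixes q :: "'a :: comm_semiring_1 poly"
  assumes "\<And>i. i \<ge> n \<Longrightarrow> coeff q i = 0"
  shows "poly q x = (\<Sum>i<n. coeff q i * x ^ i)"
proof -
  have "poly q x = (\<Sum>i\<in>{..degree q} \<union> {..<n}. coeff q i * x ^ i)"
    unfolding poly_altdef by (rule sum.mono_neutral_left) (auto simp: coeff_eq_0)
  also have "\<dots> = (\<Sum>i<n. coeff q i * x ^ i)"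
    by (rule sum.mono_neutral_right) (auto simp: assms)
  finally show ?thesis .
qed

text \<open>A kernel vector lists the coefficients of a polynomial of degree below n with n distinct
  roots, so it is zero.\<close>

lemma invertible_vandermonde:
  fixes x :: "nat \<Rightarrow> 'a :: field"
  assumes inj: "inj_on x {..<n}"
  shows "invertible_mat (mat n n (\<lambda>(j, k). x j ^ k))"
proof -
  define V where "V = mat n n (\<lambda>(j, k). x j ^ k)"
  have V: "V \<in> carrier_mat n n"
    by (simp add: V_def)
  have "det V \<noteq> 0"
  proof
    assume "det V = 0"
    then obtain v where v: "v \<in> carrier_vec n" "v \<noteq> 0\<^sub>v n" "V *\<^sub>v v = 0\<^sub>v n"
      using det_0_iff_vec_prod_zero_field[OF V] by blast
    define q where "q = (\<Sum>i<n. monom (v $ i) i)"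
    have coeff_q: "coeff q i = (if i < n then v $ i else 0)" for i
      by (simp add: q_def coeff_sum)
    have "n > 0"
      using v by (cases n) auto
    have "q = 0"
    proof (rule poly_eqI_degree[where A = "x ` {..<n}"])
      have "degree q \<le> n - 1"
        by (rule degree_le) (auto simp: coeff_q)
      thus "degree q < card (x ` {..<n})" "degree (0 :: 'a poly) < card (x ` {..<n})"
        using \<open>n > 0\<close> by (auto simp: card_image[OF inj])
      fix y assume "y \<in> x ` {..<n}"
      then obtain j where j: "j < n" "y = x j" by auto
      have "poly q y = (\<Sum>i<n. x j ^ i * v $ i)"
        by (simp add: q_def poly_sum poly_monom j mult.commute)
      also have "\<dots> = (V *\<^sub>v v) $ j"
        using j v(1) by (simp add: V_def scalar_prod_def lessThan_atLeast0)
      also have "\<dots> = 0" using v j by simp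
      finally show "poly q y = poly 0 y" by simp
    qed
    hence "v $ i = 0" if "i < n" for i
      using coeff_q[of i] that by simp
    hence "v = 0\<^sub>v n"
      using v(1) by auto
    with v show False by simp
  qed
  hence "V \<in> Units (ring_mat TYPE('a) n ())"
    by (rule det_non_zero_imp_unit[OF V])
  then obtain W where "W \<in> carrier_mat n n" "V * W = 1\<^sub>m n" "W * V = 1\<^sub>m n"
    by (auto simp: Units_def ring_mat_def)
  thus ?thesis
    using V unfolding V_def[symmetric] invertible_mat_def inverts_mat_def by auto
qed

context
  fixes A :: "'a :: comm_ring_1 set"
  assumes one: "1 \<in> A" and diff: "\<And>x y. x \<in> A \<Longrightarrow> y \<in> A \<Longrightarrow> x - y \<in> A"
    and mult: "\<And>x y. x \<in> A \<Longrightarrow> y \<in> A \<Longrightarrow> x * y \<in> A"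
begin

text \<open>The remainder is built by multiplying by x and subtracting the multiple of P that
  cancels the coefficient at d. As P is monic this needs no division and stays inside A.\<close>

lemma power_mod_monic:
  fixes P :: "'a poly"
  assumes P: "\<And>i. coeff P i \<in> A" "degree P = d" "coeff P d = 1" "d > 0"
  shows "\<exists>q. (\<forall>i. coeff q i \<in> A) \<and> (\<forall>i\<ge>d. coeff q i = 0) \<and>
    (\<forall>x. poly P x = 0 \<longrightarrow> poly q x = x ^ m)"
proof (induction m)
  case 0
  have "0 \<in> A" using diff[OF one one] by simp
  thus ?case
    using one \<open>d > 0\<close> by (intro exI[of _ 1]) auto
next
  case (Suc m)
  then obtain q where q: "\<And>i. coeff q i \<in> A" "\<And>i. i \<ge> d \<Longrightarrow> coeff q i = 0"
    "\<And>x. poly P x = 0 \<Longrightarrow> poly q x = x ^ m" by blast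
  define q' where "q' = pCons 0 q - smult (coeff q (d - 1)) P"
  have "0 \<in> A" using diff[OF one one] by simp
  hence "coeff (pCons 0 q) i \<in> A" for i
    by (auto simp: coeff_pCons q split: nat.splits)
  hence "coeff q' i \<in> A" for i
    unfolding q'_def coeff_diff coeff_smult by (intro diff mult q P)
  moreover have "coeff q' i = 0" if "i \<ge> d" for i
  proof (cases "i = d")
    case True
    thus ?thesis using P by (cases d) (auto simp: q'_def)
  next
    case False
    thus ?thesis using that P q(2)[of "i - 1"]
      by (cases i) (auto simp: q'_def coeff_eq_0)
  qed
  moreover have "poly q' x = x ^ Suc m" if "poly P x = 0" for x
    using that by (simp add: q'_def q)
  ultimately show ?case by blast
qed

end

section \<open>The entries of S V as Gauss sums\<close>

context odd_prime begin

lemma sum_res_split: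
  assumes "periodic f"
  shows "sum f res = f 0 + (\<Sum>l=1..r. f (int l) + f (- int l))"
proof -
  have "res = {0} \<union> (int ` {1..r} \<union> (\<lambda>l. int p - int l) ` {1..r})"
  proof (intro equalityI subsetI)
    fix x assume x: "x \<in> res"
    consider "x = 0" | "1 \<le> x" "x \<le> int r" | "int r < x"
      using x by (cases "x = 0"; cases "x \<le> int r") (auto simp: res_def)
    thus "x \<in> {0} \<union> (int ` {1..r} \<union> (\<lambda>l. int p - int l) ` {1..r})"
    proof cases
      case 2
      thus ?thesis by (auto intro!: image_eqI[of _ int "nat x"])
    next
      case 3
      thus ?thesis using x p_eq
        by (auto simp: res_def intro!: image_eqI[of _ "\<lambda>l. int p - int l" "nat (int p - x)"])
    qed auto
  qed (use p_eq in \<open>auto simp: res_def\<close>)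
  hence "sum f res = f 0 + sum f (int ` {1..r} \<union> (\<lambda>l. int p - int l) ` {1..r})"
    using p_eq by (simp add: sum.union_disjoint) (subst sum.insert, auto)
  also have "sum f (int ` {1..r} \<union> (\<lambda>l. int p - int l) ` {1..r}) =
      sum f (int ` {1..r}) + sum f ((\<lambda>l. int p - int l) ` {1..r})"
    using p_eq by (intro sum.union_disjoint) auto
  also have "\<dots> = (\<Sum>l=1..r. f (int l)) + (\<Sum>l=1..r. f (int p - int l))"
    by (subst (1 2) sum.reindex) (auto simp: inj_on_def)
  also have "(\<Sum>l=1..r. f (int p - int l)) = (\<Sum>l=1..r. f (- int l))"
    by (intro sum.cong refl periodicD[OF assms]) (simp add: cong_iff_dvd_diff)
  finally show ?thesis by (simp add: sum.distrib)
qed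

lemma not_p_dvd_small: "0 < j \<Longrightarrow> j < p \<Longrightarrow> \<not> int p dvd int j"
  by (auto dest: nat_dvd_not_less)

text \<open>Each residue is the square of some j from 1 to r, after a change of sign if necessary.
  The bound makes the interpolating polynomials fit into r + 1 coefficients.\<close>

lemma card_Sq_le: "card Sq \<le> r"
proof -
  have "Sq \<subseteq> (\<lambda>j. (int j)\<^sup>2 mod int p) ` {1..r}"
  proof
    fix n assume "n \<in> Sq"
    hence n: "n \<in> res" "chi n = 1" by (auto simp: Sq_def)
    then obtain y where y: "[y\<^sup>2 = n] (mod int p)" "\<not> int p dvd y"
      using chi_eq_1D by blast
    define x where "x = nat (y mod int p)"
    have x: "int x = y mod int p" "x < p"
      using p_gt_2 by (auto simp: x_def nat_less_iff)
    have "x > 0"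
      using x y(2) by (cases x) (auto simp: mod_eq_0_iff_dvd)
    define j where "j = (if x \<le> r then x else p - x)"
    have "j \<in> {1..r}"
      using x \<open>x > 0\<close> p_eq by (auto simp: j_def)
    moreover have "[int j = y] (mod int p) \<or> [int j = - y] (mod int p)"
    proof (cases "x \<le> r")
      case False
      have "int j = int p - y mod int p"
        using False x by (simp add: j_def of_nat_diff)
      thus ?thesis
        by (simp add: cong_def mod_diff_eq mod_minus_eq)
    qed (simp add: j_def x)
    hence "[(int j)\<^sup>2 = y\<^sup>2] (mod int p)"
      using cong_pow[of "int j" "-y" "int p" 2] cong_pow[of "int j" y "int p" 2] by auto
    hence "(int j)\<^sup>2 mod int p = n"
      using y(1) n(1) by (metis cong_def mod_res)
    ultimately show "n \<in> (\<lambda>j. (int j)\<^sup>2 mod int p) ` {1..r}" by blast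
  qed
  thus ?thesis
    using card_mono[of "(\<lambda>j. (int j)\<^sup>2 mod int p) ` {1..r}" Sq] card_image_le[of "{1..r}"]
    by (metis card_atLeastAtMost diff_Suc_1 finite_atLeastAtMost finite_imageI order_trans)
qed

context
  fixes a :: int
  assumes a: "\<not> int p dvd a"
begin

definition \<theta> :: "nat \<Rightarrow> complex" where "\<theta> j = z (a * (int j)\<^sup>2)"

text \<open>Equal nodes force j = k or j = -k modulo p, while both |j - k| and j + k are less than
  p.\<close>

lemma inj_on_\<theta>: "inj_on \<theta> {..<r + 1}"
proof (rule inj_onI)
  fix j k assume jk: "j \<in> {..<r + 1}" "k \<in> {..<r + 1}" "\<theta> j = \<theta> k"
  hence "[a * (int j)\<^sup>2 = a * (int k)\<^sup>2] (mod int p)"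
    by (simp add: \<theta>_def z_eq_iff)
  hence "[(int j)\<^sup>2 = (int k)\<^sup>2] (mod int p)"
    using a by (simp add: cong_mult_lcancel coprime_iff)
  hence "int p dvd (int j - int k) * (int j + int k)"
    by (simp add: cong_iff_dvd_diff power2_eq_square algebra_simps)
  hence "int p dvd int j - int k \<or> int p dvd int j + int k"
    using prime_int_p by (simp add: prime_dvd_mult_iff)
  thus "j = k"
  proof
    assume "int p dvd int j - int k"
    moreover have "\<bar>int j - int k\<bar> < int p"
      using jk p_eq by auto
    ultimately show ?thesis
      using dvd_imp_le_int[of "int j - int k" "int p"] by fastforce
  next
    assume "int p dvd int j + int k"
    moreover have "j + k < p"
      using jk p_eq by auto
    ultimately show ?thesis
      using not_p_dvd_small[of "j + k"] by (cases "j + k = 0") auto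
  qed
qed

lemma V_mat_eq: "V_mat p a = mat (r + 1) (r + 1) (\<lambda>(j, k). \<theta> j ^ k)"
  by (simp add: V_mat_def r_def \<theta>_def z_def Qf_def Let_def)

lemma S_mat_entry:
  assumes "j \<le> r" "l \<le> r"
  shows "S_mat p a $$ (j, l) =
    (if l = 0 then 1 else z (- (2 * a * int j * int l)) + z (2 * a * int j * int l)) / g"
proof -
  have B: "Bf p a (int j) (int l) = of_int (2 * a * int j * int l) / of_nat p"
    using p_gt_2 by (simp add: Bf_def Qf_def power2_eq_square field_simps)
  have "- Bf p a (int j) (int l) = of_int (- (2 * a * int j * int l)) / of_nat p"
    unfolding B by simp
  with B show ?thesis
    using assms unfolding S_mat_def Let_def z_def g_def r_def[symmetric]
    by (auto simp: e2pi_def)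
qed

text \<open>The two exponentials in column l > 0 of S belong to x = l and x = -l, and column 0 to x
  = 0, so the matrix product unfolds to a sum over all residues.\<close>

lemma S_V_entry:
  assumes "j \<le> r" "k \<le> r"
  shows "(S_mat p a * V_mat p a) $$ (j, k) =
    (\<Sum>x\<in>res. z (a * (int k * x\<^sup>2 - 2 * int j * x))) / g"
proof -
  define f where "f x = z (a * (int k * x\<^sup>2 - 2 * int j * x))" for x
  have dim: "dim_row (S_mat p a) = r + 1" "dim_col (S_mat p a) = r + 1"
    by (simp_all add: S_mat_def Let_def r_def)
  have "(S_mat p a * V_mat p a) $$ (j, k) = (\<Sum>l\<in>{0..<r + 1}. S_mat p a $$ (j, l) * \<theta> l ^ k)"
    using assms dim by (simp add: scalar_prod_def V_mat_eq del: sum.op_ivl_Suc)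
  also have "{0..<r + 1} = insert 0 {1..r}" by auto
  also have "(\<Sum>l\<in>insert 0 {1..r}. S_mat p a $$ (j, l) * \<theta> l ^ k)
      = f 0 / g + (\<Sum>l=1..r. (f (int l) + f (- int l)) / g)"
  proof (subst sum.insert)
    have "S_mat p a $$ (j, 0) * \<theta> 0 ^ k = f 0 / g"
      using assms by (simp add: S_mat_entry f_def \<theta>_def)
    moreover have "S_mat p a $$ (j, l) * \<theta> l ^ k = (f (int l) + f (- int l)) / g"
      if "l \<in> {1..r}" for l
    proof -
      have "f (int l) = z (- (2 * a * int j * int l)) * \<theta> l ^ k"
        "f (- int l) = z (2 * a * int j * int l) * \<theta> l ^ k"
        by (simp_all add: f_def \<theta>_def z_power algebra_simps flip: z_add)
      thus ?thesis
        using that assms by (simp add: S_mat_entry field_simps)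
    qed
    ultimately show "S_mat p a $$ (j, 0) * \<theta> 0 ^ k + (\<Sum>l=1..r. S_mat p a $$ (j, l) * \<theta> l ^ k) =
        f 0 / g + (\<Sum>l=1..r. (f (int l) + f (- int l)) / g)"
      by simp
  qed auto
  also have "\<dots> = sum f res / g"
  proof -
    have "periodic f"
      unfolding f_def by (intro periodicI z_cong cong_mult cong_diff cong_pow) auto
    thus ?thesis
      by (simp add: sum_res_split add_divide_distrib sum_divide_distrib)
  qed
  finally show ?thesis by (simp add: f_def)
qed

text \<open>For k = 0 the exponent is linear in x, so orthogonality applies.\<close>

lemma S_V_entry_0:
  assumes "j \<le> r"
  shows "(S_mat p a * V_mat p a) $$ (j, 0) = (if j = 0 then of_nat p / g else 0)"
proof -
  have "\<not> int p dvd 2"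
    using p_gt_2 zdvd_imp_le[of "int p" 2] by auto
  moreover have "int p dvd int j \<longleftrightarrow> j = 0"
    using not_p_dvd_small[of j] assms p_eq by (cases "j = 0") auto
  ultimately have "int p dvd - (2 * a * int j) \<longleftrightarrow> j = 0"
    using a prime_int_p by (simp add: prime_dvd_mult_iff)
  thus ?thesis
    using S_V_entry[OF assms, of 0] sum_z[of "- (2 * a * int j)"] by (simp add: mult_ac)
qed

text \<open>Completing the square with x = y - m j turns k x^2 - 2 j x into k y^2 + m j^2 modulo p.
  The Gauss sum over y cancels the denominator \<open>g\<close> up to a sign.\<close>

lemma S_V_entry_pos:
  assumes "j \<le> r" "0 < k" "k \<le> r" and m: "[int k * int m = -1] (mod int p)"
  shows "(S_mat p a * V_mat p a) $$ (j, k) = of_int (chi (a * int k)) * \<theta> j ^ m"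
proof -
  have k: "\<not> int p dvd a * int k"
    using assms p_eq not_p_dvd_small[of k] a prime_int_p by (simp add: prime_dvd_mult_iff)
  define f where "f x = z (a * (int k * x\<^sup>2 - 2 * int j * x))" for x
  define t where "t = - (int m * int j)"
  have "periodic f"
    unfolding f_def by (intro periodicI z_cong cong_mult cong_diff cong_pow) auto
  hence "sum f res = (\<Sum>y\<in>res. f (y + t))"
    by (rule sum_res_shift[symmetric])
  also have "\<dots> = (\<Sum>y\<in>res. \<theta> j ^ m * z (a * int k * y\<^sup>2))"
  proof (intro sum.cong refl)
    fix y
    have "int p dvd int k * int m + 1"
      using m by (simp add: cong_iff_dvd_diff)
    \<comment> \<open>This multiple of k m + 1 is exactly the difference of the two
      exponents.\<close>
    hence "int p dvd (int k * int m + 1) * (a * int j * (int m * int j - 2 * y))"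
      by (rule dvd_mult2)
    also have "(int k * int m + 1) * (a * int j * (int m * int j - 2 * y)) =
        a * (int k * (y + t)\<^sup>2 - 2 * int j * (y + t)) -
        (a * (int j)\<^sup>2 * int m + a * int k * y\<^sup>2)"
      by (simp add: t_def power2_eq_square algebra_simps)
    finally show "f (y + t) = \<theta> j ^ m * z (a * int k * y\<^sup>2)"
      by (simp add: f_def \<theta>_def z_power z_eq_iff cong_iff_dvd_diff flip: z_add)
  qed
  also have "\<dots> = \<theta> j ^ m * G (a * int k)"
    by (simp add: G_def sum_distrib_left)
  also have "\<dots> = of_int (chi (a * int k)) * \<theta> j ^ m * g"
    by (simp add: G_eq_chi_g[OF k])
  finally show ?thesis
    using S_V_entry[OF assms(1,3)] g_nonzero by (simp add: f_def)
qed

section \<open>Integral interpolation of the columns at the nodes\<close>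

lemma degree_Rp: "degree (Rp a) = card Sq"
  by (simp add: Rp_def degree_prod_eq_sum_degree)

lemma lead_coeff_Rp: "coeff (Rp a) (card Sq) = 1"
  using lead_coeff_prod[of "\<lambda>n. [:- z (a * n), 1:]" Sq] degree_Rp by (simp add: Rp_def)

lemma poly_Rp_\<theta>:
  assumes "0 < j" "j \<le> r"
  shows "poly (Rp a) (\<theta> j) = 0"
proof -
  have j: "\<not> int p dvd int j"
    using assms p_eq by (intro not_p_dvd_small) auto
  have "(int j)\<^sup>2 mod int p \<in> Sq"
    using chi_square[OF j] chi_cong[of "(int j)\<^sup>2 mod int p" "(int j)\<^sup>2"] by (simp add: Sq_def)
  moreover have "\<theta> j = z (a * ((int j)\<^sup>2 mod int p))"
    unfolding \<theta>_def by (intro z_cong cong_scalar_left) auto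
  ultimately show ?thesis
    by (auto simp: Rp_def poly_prod)
qed

lemma S_V_column:
  assumes "k \<le> r"
  shows "\<exists>q. (\<forall>i. coeff q i \<in> ring_Zomega p) \<and> (\<forall>i\<ge>r + 1. coeff q i = 0) \<and>
    (\<forall>j\<le>r. (S_mat p a * V_mat p a) $$ (j, k) = poly q (\<theta> j))"
proof (cases "k = 0")
  case True
  \<comment> \<open>\<open>Rp a\<close> vanishes at every node except \<open>\<theta> 0 = 1\<close>,
    where its value is \<open>T a\<close>; the factor corrects this value to p/g.\<close>
  define q where "q = smult (of_nat p / g / T a) (Rp a)"
  have "coeff q i \<in> ring_Zomega p" for i
    unfolding q_def coeff_smult
    by (intro Zomega_mult p_over_g_T_Zomega[OF a] coeff_Rp_Zomega[OF a])
  moreover have "coeff q i = 0" if "i \<ge> r + 1" for i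
    using that card_Sq_le by (simp add: q_def coeff_eq_0 degree_Rp)
  moreover have "(S_mat p a * V_mat p a) $$ (j, k) = poly q (\<theta> j)" if "j \<le> r" for j
    using that True S_V_entry_0[OF that] poly_Rp_\<theta>[of j] p_over_g_T_Zomega(1)[OF a]
    by (cases "j = 0") (simp_all add: q_def poly_Rp_1 \<theta>_def)
  ultimately show ?thesis by blast
next
  case False
  \<comment> \<open>This is (x - 1) times \<open>Rp a\<close>, which vanishes at all nodes; as a
    difference its coefficients are visibly in the ring.\<close>
  define P where "P = pCons 0 (Rp a) - Rp a"
  have P_eq: "P = [:-1, 1:] * Rp a"
    by (simp add: P_def)
  have Rp_nz: "Rp a \<noteq> 0"
    using lead_coeff_Rp by auto
  have "coeff (pCons 0 (Rp a)) i \<in> ring_Zomega p" for i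
    using coeff_Rp_Zomega[OF a] Zomega_of_int[of 0] by (auto simp: coeff_pCons split: nat.splits)
  hence "coeff P i \<in> ring_Zomega p" for i
    unfolding P_def coeff_diff by (intro Zomega_diff coeff_Rp_Zomega[OF a])
  moreover have "degree P = card Sq + 1"
    unfolding P_eq using Rp_nz by (subst degree_mult_eq) (auto simp: degree_Rp)
  moreover have "coeff P (card Sq + 1) = 1"
    using lead_coeff_Rp by (simp add: P_def coeff_eq_0 degree_Rp)
  ultimately have reduce: "\<exists>q. (\<forall>i. coeff q i \<in> ring_Zomega p) \<and> (\<forall>i\<ge>card Sq + 1. coeff q i = 0) \<and>
      (\<forall>x. poly P x = 0 \<longrightarrow> poly q x = x ^ m)" for m
    using Zomega_of_int[of 1] by (intro power_mod_monic Zomega_diff Zomega_mult) auto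
  have "\<not> int p dvd int k"
    using False assms p_eq by (intro not_p_dvd_small) auto
  then obtain k' where k': "[int k * k' = 1] (mod int p)"
    using inverse_mod by blast
  \<comment> \<open>A nonnegative representative of -1/k, fit to be an exponent.\<close>
  define m where "m = nat ((- k') mod int p)"
  have "[int k * int m = int k * (- k')] (mod int p)"
    using p_gt_2 by (intro cong_scalar_left) (simp add: m_def)
  also have "[int k * (- k') = - 1] (mod int p)"
    using k' by (simp add: cong_minus_minus_iff)
  finally have m: "[int k * int m = -1] (mod int p)" .
  obtain q where q: "\<And>i. coeff q i \<in> ring_Zomega p" "\<And>i. i \<ge> card Sq + 1 \<Longrightarrow> coeff q i = 0"
    "\<And>x. poly P x = 0 \<Longrightarrow> poly q x = x ^ m"
    using reduce[of m] by blast
  define q' where "q' = smult (of_int (chi (a * int k))) q"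
  have "coeff q' i \<in> ring_Zomega p" for i
    by (simp add: q'_def Zomega_mult Zomega_of_int q)
  moreover have "coeff q' i = 0" if "i \<ge> r + 1" for i
    using that card_Sq_le by (simp add: q'_def q)
  moreover have "(S_mat p a * V_mat p a) $$ (j, k) = poly q' (\<theta> j)" if "j \<le> r" for j
  proof -
    have "poly P (\<theta> j) = 0"
      using poly_Rp_\<theta>[of j] that by (cases "j = 0") (auto simp: P_eq \<theta>_def)
    thus ?thesis
      using S_V_entry_pos[OF that _ assms m] False by (simp add: q'_def q)
  qed
  ultimately show ?thesis by blast
qed

text \<open>Row j of V times a coefficient vector evaluates the polynomial at
  \<open>\<theta> j\<close>, so the coefficients of the interpolating polynomials are the columns of
  D.\<close>

lemma S_V_eq_V_mult:
  "\<exists>D\<in>carrier_mat (r + 1) (r + 1). S_mat p a * V_mat p a = V_mat p a * D \<and>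
    (\<forall>i\<le>r. \<forall>k\<le>r. D $$ (i, k) \<in> ring_Zomega p)"
proof -
  obtain q where q: "\<And>k i. k \<le> r \<Longrightarrow> coeff (q k) i \<in> ring_Zomega p"
    "\<And>k i. k \<le> r \<Longrightarrow> i \<ge> r + 1 \<Longrightarrow> coeff (q k) i = 0"
    "\<And>k j. k \<le> r \<Longrightarrow> j \<le> r \<Longrightarrow> (S_mat p a * V_mat p a) $$ (j, k) = poly (q k) (\<theta> j)"
    using S_V_column by metis
  define D where "D = mat (r + 1) (r + 1) (\<lambda>(i, k). coeff (q k) i)"
  have "S_mat p a * V_mat p a = V_mat p a * D"
  proof (rule eq_matI)
    fix j k assume "j < dim_row (V_mat p a * D)" "k < dim_col (V_mat p a * D)"
    hence jk: "j \<le> r" "k \<le> r"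
      by (auto simp: V_mat_eq D_def)
    have "(V_mat p a * D) $$ (j, k) = (\<Sum>i<r + 1. coeff (q k) i * \<theta> j ^ i)"
      using jk by (simp add: V_mat_eq D_def scalar_prod_def lessThan_atLeast0 mult.commute)
    also have "\<dots> = poly (q k) (\<theta> j)"
      by (rule poly_eq_sum_coeff[symmetric]) (use q(2) jk in auto)
    finally show "(S_mat p a * V_mat p a) $$ (j, k) = (V_mat p a * D) $$ (j, k)"
      using q(3)[OF jk(2,1)] by simp
  qed (auto simp: V_mat_eq D_def S_mat_def Let_def r_def)
  moreover have "D \<in> carrier_mat (r + 1) (r + 1)"
    by (simp add: D_def)
  moreover have "\<forall>i\<le>r. \<forall>k\<le>r. D $$ (i, k) \<in> ring_Zomega p"
    using q(1) by (simp add: D_def)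
  ultimately show ?thesis by blast
qed

end
end

theorem theorem3:
  fixes p :: nat and a :: int
  assumes "prime p" and "odd p"
    and "a = 1 \<or> \<not> QuadRes (int p) a"
  shows "invertible_mat (V_mat p a) \<and>
    (\<forall>Vi \<in> carrier_mat ((p - 1) div 2 + 1) ((p - 1) div 2 + 1).
       Vi * V_mat p a = 1\<^sub>m ((p - 1) div 2 + 1) \<longrightarrow>
       (\<forall>j \<le> (p - 1) div 2. \<forall>k \<le> (p - 1) div 2.
          (Vi * S_mat p a * V_mat p a) $$ (j, k) \<in> ring_Zomega p))"
proof -
  interpret odd_prime p
    by unfold_locales (fact assms)+
  \<comment> \<open>\<open>QuadRes\<close> counts 0 as a square, so a non-residue is a unit.\<close>
  have "QuadRes (int p) a" if "int p dvd a"
    using that unfolding QuadRes_def by (intro exI[of _ 0]) (simp add: cong_iff_dvd_diff)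
  with assms(3) have a: "\<not> int p dvd a"
    by auto
  have V: "V_mat p a \<in> carrier_mat (r + 1) (r + 1)"
    by (simp add: V_mat_eq[OF a])
  have S: "S_mat p a \<in> carrier_mat (r + 1) (r + 1)"
    by (simp add: S_mat_def Let_def r_def)
  obtain D where D: "D \<in> carrier_mat (r + 1) (r + 1)" "S_mat p a * V_mat p a = V_mat p a * D"
    "\<And>i k. i \<le> r \<Longrightarrow> k \<le> r \<Longrightarrow> D $$ (i, k) \<in> ring_Zomega p"
    using S_V_eq_V_mult[OF a] by blast
  have "Vi * S_mat p a * V_mat p a = D"
    if Vi: "Vi \<in> carrier_mat (r + 1) (r + 1)" "Vi * V_mat p a = 1\<^sub>m (r + 1)" for Vi
  proof -
    \<comment> \<open>Any left inverse of V cancels against S V = V D.\<close>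
    have "Vi * S_mat p a * V_mat p a = Vi * V_mat p a * D"
      using Vi(1) V S D by (simp add: assoc_mult_mat[of _ "r + 1" "r + 1" _ "r + 1" _ "r + 1"])
    thus ?thesis using Vi D by simp
  qed
  moreover have "invertible_mat (V_mat p a)"
    unfolding V_mat_eq[OF a] by (rule invertible_vandermonde[OF inj_on_\<theta>[OF a]])
  ultimately show ?thesis
    using D(3) unfolding r_def[symmetric] by simp
qed

end
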